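(* Let $f:\mathbb{R}^d\to\mathbb{R}$ be $\rho$-weakly convex ($\rho\ge0$) with bounded sublevel sets, with nonempty set of minimizers and $f^*=\min_{x\in\mathbb{R}^d} f(x)$. Let $0<\lambda<1/\rho$ and let $f_\lambda$ be the Moreau envelope of $f$. Let $T\ge0$ be an integer, $c>0$, $x^0\in\mathbb{R}^d$, and let the iterates be generated by the subgradient method $x^{k+1}=x^k-\alpha_k g(x^k)$ with $g(x^k)\in\partial f(x^k)$ and step sizes $$\alpha_k=\frac{\beta_k}{\|g(x^k)\|},\qquad \beta_k=\frac{c}{\sqrt{T+1}},\qquad k=0,1,\ldots,T.$$ Then the trajectory $\{x^k\}_{k=0}^T$ lies in the bounded sublevel set $\mathcal{B}:=\{x\in\mathbb{R}^d: f_\lambda(x)\le f_\lambda(x^0)+\frac{c^2}{2\lambda}\}$. Consequently, for any bounded open convex set $\mathcal{B}'$ that contains $\mathcal{B}$, $$\min_{0\le k\le T}\|\nabla f_\lambda(x^k)\|^2\le\frac{L_{\mathcal{B}'}\left(f_\lambda(x^0)-f^*+\frac{c^2}{2\lambda}\right)}{c(1-\lambda\rho)\sqrt{T+1}},$$ where $L_{\mathcal{B}'}>0$ is the Lipschitz constant of $f$ on $\mathcal{B}'$.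
   Context: $\|\cdot\|$ is the Euclidean norm. $f$ is $\rho$-weakly convex if $\phi(x)=f(x)+\frac{\rho}{2}\|x\|^2$ is convex; its subdifferential is $\partial f(x)=\partial\phi(x)-\rho x$, with $\partial\phi$ the convex subdifferential, and $g(x^k)$ is an arbitrarily chosen element of $\partial f(x^k)$. If $g(x^k)=0$, then $x^{k+1}=x^k$ regardless of the value assigned to $\alpha_k$. $f$ has bounded sublevel sets if $\{x\in\mathbb{R}^d:f(x)\le s\}$ is bounded for every $s\in\mathbb{R}$. The Moreau envelope is $f_\lambda(x)=\min_{y\in\mathbb{R}^d}\{f(y)+\frac{1}{2\lambda}\|y-x\|^2\}$; for $\lambda<1/\rho$ (with $1/0=+\infty$) it is differentiable. $f$ is not assumed globally Lipschitz; finite-valued weakly convex functions are automatically Lipschitz on bounded sets, so $L_{\mathcal{B}'}>0$ with $|f(x)-f(y)|\le L_{\mathcal{B}'}\|x-y\|$ on $\mathcal{B}'$ exists. *)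

theory Defs
  imports "HOL-Analysis.Analysis"
begin

definition weakly_convex :: "real \<Rightarrow> ('a::real_inner \<Rightarrow> real) \<Rightarrow> bool" where
  "weakly_convex \<rho> f \<longleftrightarrow> convex_on UNIV (\<lambda>x. f x + \<rho> / 2 * (norm x)\<^sup>2)"

definition convex_subdiff :: "('a::real_inner \<Rightarrow> real) \<Rightarrow> 'a \<Rightarrow> 'a set" where
  "convex_subdiff \<phi> x = {v. \<forall>y. \<phi> y \<ge> \<phi> x + v \<bullet> (y - x)}"

definition weak_subdiff :: "real \<Rightarrow> ('a::real_inner \<Rightarrow> real) \<Rightarrow> 'a \<Rightarrow> 'a set" where
  "weak_subdiff \<rho> f x =
    (\<lambda>v. v - \<rho> *\<^sub>R x) ` convex_subdiff (\<lambda>z. f z + \<rho> / 2 * (norm z)\<^sup>2) x"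

(* The LEAST element of the range is the minimum, and it is unspecified when
   the minimum is not attained. *)
definition min_value :: "('a \<Rightarrow> real) \<Rightarrow> real" where
  "min_value h = (LEAST v. v \<in> range h)"

definition moreau_envelope :: "real \<Rightarrow> ('a::real_normed_vector \<Rightarrow> real) \<Rightarrow> 'a \<Rightarrow> real" where
  "moreau_envelope lam f x = min_value (\<lambda>y. f y + 1 / (2 * lam) * (norm (y - x))\<^sup>2)"

(* Unspecified at points where h is not differentiable. *)
definition gradient :: "('a::real_inner \<Rightarrow> real) \<Rightarrow> 'a \<Rightarrow> 'a" where
  "gradient h x = (THE D. GDERIV h x :> D)"

end

theory Submission
  imports Defs
begin

text \<open>Write \<open>p\<close> for the proximal point of \<open>x\<close>, so that the gradient of the envelope at \<open>x\<close> is
  \<open>(x - p) / lam\<close>. The prox objective is strongly convex with modulus \<open>1 / lam - \<rho>\<close>; combined with the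
  subgradient inequality this gives \<open>g \<bullet> (p - x) \<le> - lam * (1 - lam * \<rho>) * \<parallel>\<nabla>f\<^sub>l\<^sub>a\<^sub>m x\<parallel>\<^sup>2\<close>. Testing the
  envelope at the next iterate with the old proximal point then yields
  \<open>f\<^sub>l\<^sub>a\<^sub>m (x - \<alpha> g) \<le> f\<^sub>l\<^sub>a\<^sub>m x - \<alpha> (1 - lam * \<rho>) \<parallel>\<nabla>f\<^sub>l\<^sub>a\<^sub>m x\<parallel>\<^sup>2 + \<parallel>\<alpha> g\<parallel>\<^sup>2 / (2 lam)\<close>. The error terms add up to
  \<open>c\<^sup>2 / (2 lam)\<close>, so the iterates stay in the sublevel set, where \<open>\<parallel>g\<parallel> \<le> L\<close>; telescoping gives the
  rate.\<close>

section \<open>Weak convexity and its subgradients\<close>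

lemma norm_convex_combination:
  fixes x y :: "'a::real_inner"
  shows "(norm ((1 - t) *\<^sub>R x + t *\<^sub>R y))\<^sup>2
    = (1 - t) * (norm x)\<^sup>2 + t * (norm y)\<^sup>2 - t * (1 - t) * (norm (y - x))\<^sup>2"
  unfolding power2_norm_eq_inner
  by (simp add: inner_add_left inner_add_right inner_diff_left inner_diff_right
      inner_commute[of y x] algebra_simps)

text \<open>Expanding the added quadratic by \<open>norm_convex_combination\<close> cancels its
  values at the end points; only the cross term survives, as the price for the missing
  convexity.\<close>

lemma weakly_convexD:
  assumes "weakly_convex \<rho> f" "0 \<le> t" "t \<le> 1"
  shows "f ((1 - t) *\<^sub>R x + t *\<^sub>R y)
    \<le> (1 - t) * f x + t * f y + \<rho> / 2 * (t * (1 - t)) * (norm (y - x))\<^sup>2"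
proof -
  have "f ((1 - t) *\<^sub>R x + t *\<^sub>R y) + \<rho> / 2 * (norm ((1 - t) *\<^sub>R x + t *\<^sub>R y))\<^sup>2
      \<le> (1 - t) * (f x + \<rho> / 2 * (norm x)\<^sup>2) + t * (f y + \<rho> / 2 * (norm y)\<^sup>2)"
    using assms convex_onD[of UNIV "\<lambda>x. f x + \<rho> / 2 * (norm x)\<^sup>2" t x y]
    by (auto simp: weakly_convex_def)
  then show ?thesis
    unfolding norm_convex_combination
    by (simp add: algebra_simps add_divide_distrib diff_divide_distrib)
qed

lemma weakly_convex_continuous_on:
  fixes f :: "'a::euclidean_space \<Rightarrow> real"
  assumes "weakly_convex \<rho> f"
  shows "continuous_on UNIV f"
proof -
  have "continuous_on UNIV (\<lambda>x. f x + \<rho> / 2 * (norm x)\<^sup>2)"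
    using assms convex_on_continuous[OF open_UNIV] by (auto simp: weakly_convex_def)
  then have "continuous_on UNIV (\<lambda>x. (f x + \<rho> / 2 * (norm x)\<^sup>2) - \<rho> / 2 * (norm x)\<^sup>2)"
    by (intro continuous_on_diff continuous_on_mult continuous_on_const continuous_on_power
        continuous_on_norm continuous_on_id)
  then show ?thesis by simp
qed

text \<open>The shift of \<open>v\<close> by \<open>\<rho> *\<^sub>R x\<close> recentres the
  quadratic: all terms carrying \<rho> collapse into one penalty in \<open>y - x\<close>.\<close>

lemma weak_subdiffD:
  assumes "g \<in> weak_subdiff \<rho> f x"
  shows "f x + g \<bullet> (y - x) - \<rho> / 2 * (norm (y - x))\<^sup>2 \<le> f y"
proof -
  from assms obtain v where g: "g = v - \<rho> *\<^sub>R x"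
    and v: "f y + \<rho> / 2 * (norm y)\<^sup>2 \<ge> f x + \<rho> / 2 * (norm x)\<^sup>2 + v \<bullet> (y - x)"
    by (auto simp: weak_subdiff_def convex_subdiff_def)
  have "(norm (y - x))\<^sup>2 = (norm y)\<^sup>2 - (norm x)\<^sup>2 - 2 * (x \<bullet> (y - x))"
    by (simp add: power2_norm_eq_inner inner_diff_left inner_diff_right inner_commute[of y x])
  then have "\<rho> / 2 * (norm (y - x))\<^sup>2
      = \<rho> / 2 * (norm y)\<^sup>2 - \<rho> / 2 * (norm x)\<^sup>2 - \<rho> * (x \<bullet> (y - x))"
    by (simp add: right_diff_distrib)
  moreover have "g \<bullet> (y - x) = v \<bullet> (y - x) - \<rho> * (x \<bullet> (y - x))"
    by (simp add: g inner_diff_left)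
  ultimately show ?thesis
    using v by linarith
qed

text \<open>Walk from \<open>x\<close> along \<open>g\<close> itself. For small \<open>t\<close> the
  point stays in the open set \<open>S\<close>; there \<open>f\<close> rises by at least
  \<open>t * (norm g)\<^sup>2\<close> up to an error of order \<open>t\<^sup>2\<close>, and by at
  most \<open>L * (t * norm g)\<close>. Divide by \<open>t * norm g\<close> and let \<open>t\<close>
  tend to 0.\<close>

lemma weak_subgradient_norm_le:
  assumes g: "g \<in> weak_subdiff \<rho> f x" and "open S" "x \<in> S" and lip: "L-lipschitz_on S f"
  shows "norm g \<le> L"
proof (cases "g = 0")
  case True
  then show ?thesis using lipschitz_on_nonneg[OF lip] by simp
next
  case False
  have "((\<lambda>t. x + t *\<^sub>R g) \<longlongrightarrow> x + 0 *\<^sub>R g) (at_right 0)"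
    by (intro tendsto_intros)
  then have "\<forall>\<^sub>F t in at_right 0. x + t *\<^sub>R g \<in> S"
    using topological_tendstoD[OF _ \<open>open S\<close>] \<open>x \<in> S\<close> by fastforce
  moreover have "\<forall>\<^sub>F t::real in at_right 0. 0 < t"
    by (simp add: eventually_at_right_less)
  ultimately have ev: "\<forall>\<^sub>F t in at_right 0. norm g - \<rho> / 2 * t * norm g \<le> L"
  proof eventually_elim
    case (elim t)
    have "t * (norm g)\<^sup>2 - \<rho> / 2 * (t\<^sup>2 * (norm g)\<^sup>2) \<le> f (x + t *\<^sub>R g) - f x"
      using weak_subdiffD[OF g, of "x + t *\<^sub>R g"] elim
      by (simp add: power2_norm_eq_inner[symmetric] power_mult_distrib)
    also have "\<dots> \<le> L * (t * norm g)"
      using lipschitz_onD[OF lip, of "x + t *\<^sub>R g" x] elim \<open>x \<in> S\<close>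
      by (simp add: dist_norm)
    finally have "(t * norm g) * (norm g - \<rho> / 2 * t * norm g) \<le> (t * norm g) * L"
      by (simp add: algebra_simps power2_eq_square)
    then show ?case
      using elim False by (simp add: mult_le_cancel_left_pos)
  qed
  have "((\<lambda>t. norm g - \<rho> / 2 * t * norm g) \<longlongrightarrow> norm g - \<rho> / 2 * 0 * norm g) (at_right 0)"
    by (intro tendsto_intros)
  then show ?thesis
    using tendsto_upperbound[OF _ ev] by simp
qed

section \<open>Proximal points\<close>

lemma min_value_eqI:
  assumes "\<And>y. h p \<le> h y"
  shows "min_value h = h p"
  unfolding min_value_def using assms by (intro Least_equality) auto

text \<open>\<open>min_value\<close> is meaningful only for an attained minimum. Since the penalty
  is nonnegative, a sublevel set of the prox objective lies in one of \<open>f\<close>, so it is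
  compact and the continuous objective attains its minimum on it.\<close>

lemma moreau_envelope_attained:
  fixes f :: "'a::euclidean_space \<Rightarrow> real"
  assumes "weakly_convex \<rho> f" and bdd: "\<And>s. bounded {z. f z \<le> s}" and "0 < lam"
  obtains p where "moreau_envelope lam f x = f p + 1 / (2 * lam) * (norm (p - x))\<^sup>2"
    and "\<And>y. moreau_envelope lam f x \<le> f y + 1 / (2 * lam) * (norm (y - x))\<^sup>2"
proof -
  define h where "h y = f y + 1 / (2 * lam) * (norm (y - x))\<^sup>2" for y
  have cont: "continuous_on UNIV h"
    unfolding h_def by (intro continuous_intros weakly_convex_continuous_on[OF assms(1)])
  have "{y. h y \<le> h x} \<subseteq> {y. f y \<le> h x}"
  proof
    fix y assume "y \<in> {y. h y \<le> h x}"
    moreover have "f y \<le> h y" using \<open>0 < lam\<close> by (simp add: h_def)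
    ultimately show "y \<in> {y. f y \<le> h x}" by simp
  qed
  then have "bounded {y. h y \<le> h x}"
    using bdd bounded_subset by blast
  moreover have "closed {y. h y \<le> h x}"
    using cont by (intro closed_Collect_le) auto
  ultimately have "compact {y. h y \<le> h x}"
    by (simp add: compact_eq_bounded_closed)
  then obtain p where p: "h p \<le> h x" "\<And>y. h y \<le> h x \<Longrightarrow> h p \<le> h y"
    using continuous_attains_inf[of "{y. h y \<le> h x}" h] continuous_on_subset[OF cont]
    by auto
  \<comment> \<open>Outside the sublevel set, \<open>h y\<close> exceeds \<open>h x\<close>, which
    is at least \<open>h p\<close>.\<close>
  have min: "h p \<le> h y" for y
    using p by (meson linear order_trans)
  then have "moreau_envelope lam f x = h p"
    unfolding moreau_envelope_def h_def[symmetric] using min_value_eqI[of h p] by simp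
  with min that[of p] show thesis
    unfolding h_def by simp
qed

text \<open>Along the segment from \<open>p\<close> to \<open>y\<close> the penalty contributes
  curvature \<open>1 / lam\<close> and weak convexity costs at most \<rho>; minimality of
  \<open>p\<close> against points of the segment turns the difference into growth.\<close>

lemma prox_quadratic_growth:
  assumes wc: "weakly_convex \<rho> f"
    and min: "\<And>y. f p + 1 / (2 * lam) * (norm (p - x))\<^sup>2 \<le> f y + 1 / (2 * lam) * (norm (y - x))\<^sup>2"
  shows "f p + 1 / (2 * lam) * (norm (p - x))\<^sup>2 + (1 / lam - \<rho>) / 2 * (norm (y - p))\<^sup>2
    \<le> f y + 1 / (2 * lam) * (norm (y - x))\<^sup>2"
proof -
  define h where "h y = f y + 1 / (2 * lam) * (norm (y - x))\<^sup>2" for y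
  \<comment> \<open>Here \<open>s\<close> is the weight on \<open>p\<close> and
    \<open>t = 1 - s\<close> the weight on \<open>y\<close>. After division by \<open>t\<close> the
    growth term still carries the factor \<open>s\<close>, which is removed by letting
    \<open>s\<close> approach 1.\<close>
  have "s * ((1 / lam - \<rho>) / 2 * (norm (y - p))\<^sup>2) \<le> h y - h p" if "0 < s" "s < 1" for s :: real
  proof -
    define t where "t = 1 - s"
    have t: "0 < t" "t < 1" using that by (auto simp: t_def)
    let ?z = "(1 - t) *\<^sub>R p + t *\<^sub>R y"
    have "(norm (?z - x))\<^sup>2
        = (1 - t) * (norm (p - x))\<^sup>2 + t * (norm (y - x))\<^sup>2 - t * (1 - t) * (norm (y - p))\<^sup>2"
    proof -
      have "?z - x = (1 - t) *\<^sub>R (p - x) + t *\<^sub>R (y - x)"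
        by (simp add: algebra_simps)
      then show ?thesis
        using norm_convex_combination[of t "p - x" "y - x"] by simp
    qed
    then have "1 / (2 * lam) * (norm (?z - x))\<^sup>2
        = (1 - t) * (1 / (2 * lam) * (norm (p - x))\<^sup>2) + t * (1 / (2 * lam) * (norm (y - x))\<^sup>2)
          - t * (1 - t) * (1 / lam / 2 * (norm (y - p))\<^sup>2)"
      by (simp only:) (simp add: diff_divide_distrib add_divide_distrib algebra_simps)
    moreover have "f ?z \<le> (1 - t) * f p + t * f y + t * (1 - t) * (\<rho> / 2 * (norm (y - p))\<^sup>2)"
      using weakly_convexD[OF wc, of t p y] t by (simp add: mult_ac)
    ultimately have "h ?z \<le> (1 - t) * h p + t * h y
        - t * (1 - t) * ((1 / lam - \<rho>) / 2 * (norm (y - p))\<^sup>2)"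
      unfolding h_def by (simp add: algebra_simps diff_divide_distrib)
    moreover have "h p \<le> h ?z"
      unfolding h_def by (rule min)
    ultimately have "t * (s * ((1 / lam - \<rho>) / 2 * (norm (y - p))\<^sup>2)) \<le> t * (h y - h p)"
      by (simp add: t_def algebra_simps)
    then show ?thesis
      using t by (simp add: mult_le_cancel_left_pos)
  qed
  then have "(1 / lam - \<rho>) / 2 * (norm (y - p))\<^sup>2 \<le> h y - h p"
    by (rule field_le_mult_one_interval)
  then show ?thesis unfolding h_def by linarith
qed

section \<open>The gradient of the envelope\<close>

lemma GDERIV_quadratic_bound:
  assumes "\<And>y. \<bar>h y - h x - D \<bullet> (y - x)\<bar> \<le> K * (norm (y - x))\<^sup>2"
  shows "GDERIV h x :> D"
  unfolding gderiv_def has_derivative_at2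
proof
  show "bounded_linear (\<lambda>h. inner h D)"
    by (rule bounded_linear_inner_left)
  have "((\<lambda>y. (h y - (h x + (y - x) \<bullet> D)) /\<^sub>R norm (y - x)) \<longlongrightarrow> 0) (at x)"
  proof (rule Lim_null_comparison)
    show "\<forall>\<^sub>F y in at x. norm ((h y - (h x + (y - x) \<bullet> D)) /\<^sub>R norm (y - x)) \<le> K * norm (y - x)"
    proof (rule always_eventually, rule allI)
      fix y
      show "norm ((h y - (h x + (y - x) \<bullet> D)) /\<^sub>R norm (y - x)) \<le> K * norm (y - x)"
      proof (cases "y = x")
        case False
        then have "0 < norm (y - x)" by simp
        then have "\<bar>h y - h x - D \<bullet> (y - x)\<bar> / norm (y - x) \<le> K * norm (y - x)"
          using assms[of y] by (simp add: divide_le_eq power2_eq_square mult.assoc)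
        moreover have "h y - (h x + (y - x) \<bullet> D) = h y - h x - D \<bullet> (y - x)"
          by (simp add: inner_commute)
        ultimately show ?thesis
          by (simp only: real_norm_def real_scaleR_def abs_mult abs_inverse abs_norm_cancel
              divide_inverse_commute)
      qed simp
    qed
    have "((\<lambda>y. K * norm (y - x)) \<longlongrightarrow> K * norm (x - x)) (at x)"
      by (intro tendsto_intros)
    then show "((\<lambda>y. K * norm (y - x)) \<longlongrightarrow> 0) (at x)" by simp
  qed
  then show "((\<lambda>y. (1 / norm (y - x)) *\<^sub>R (h y - (h x + (y - x) \<bullet> D))) \<longlongrightarrow> 0) (at x)"
    by (simp add: inverse_eq_divide)
qed

lemma gradient_eqI:
  assumes "GDERIV h x :> D"
  shows "gradient h x = D"
  unfolding gradient_def
proof (rule the_equality)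
  fix E assume "GDERIV h x :> E"
  then have "(\<lambda>y. y \<bullet> E) = (\<lambda>y. y \<bullet> D)"
    using assms has_derivative_unique unfolding gderiv_def by blast
  then show "E = D"
    by (metis vector_eq_rdot inner_commute)
qed (fact assms)

text \<open>The envelope is squeezed between two quadratics with the same linear part. Above:
  \<open>p\<close> is a candidate at \<open>y\<close>. Below: the proximal point \<open>q\<close> of
  \<open>y\<close> is compared with \<open>p\<close> by quadratic growth, which penalises
  \<open>q\<close> for being far from \<open>p\<close>.\<close>

lemma gradient_moreau_envelope:
  fixes f :: "'a::euclidean_space \<Rightarrow> real"
  assumes wc: "weakly_convex \<rho> f" and bdd: "\<And>s. bounded {z. f z \<le> s}"
    and lam: "0 < lam" "lam * \<rho> < 1"
    and p: "moreau_envelope lam f x = f p + 1 / (2 * lam) * (norm (p - x))\<^sup>2"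
    and min: "\<And>y. moreau_envelope lam f x \<le> f y + 1 / (2 * lam) * (norm (y - x))\<^sup>2"
  shows "gradient (moreau_envelope lam f) x = (x - p) /\<^sub>R lam"
proof (rule gradient_eqI, rule GDERIV_quadratic_bound)
  fix y
  let ?M = "moreau_envelope lam f"
  define \<mu> where "\<mu> = 1 / lam - \<rho>"
  define d where "d = norm (y - x)"
  have \<mu>: "0 < \<mu>"
    using lam by (simp add: \<mu>_def field_simps)
  \<comment> \<open>Splitting \<open>z - x\<close> at \<open>p\<close> isolates the candidate
    gradient; the other linear term vanishes for \<open>z = p\<close> and is handled by
    Cauchy-Schwarz for \<open>z = q\<close>.\<close>
  have expand: "1 / (2 * lam) * (norm (z - y))\<^sup>2 = 1 / (2 * lam) * (norm (z - x))\<^sup>2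
      - ((z - p) \<bullet> (y - x)) / lam + ((x - p) /\<^sub>R lam) \<bullet> (y - x) + 1 / (2 * lam) * d\<^sup>2" for z
  proof -
    have "(norm (z - y))\<^sup>2 = (norm (z - x))\<^sup>2 - 2 * ((z - p) \<bullet> (y - x)) + 2 * ((x - p) \<bullet> (y - x)) + d\<^sup>2"
      unfolding d_def
      by (simp add: power2_norm_eq_inner inner_diff_left inner_diff_right inner_commute[of y x]
          inner_commute[of y z] inner_commute[of x z])
    moreover have "((x - p) /\<^sub>R lam) \<bullet> (y - x) = ((x - p) \<bullet> (y - x)) / lam"
      by (simp add: divide_inverse_commute)
    ultimately show ?thesis
      using lam by (simp add: field_simps)
  qed
  obtain q where q: "?M y = f q + 1 / (2 * lam) * (norm (q - y))\<^sup>2"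
    and minq: "\<And>z. ?M y \<le> f z + 1 / (2 * lam) * (norm (z - y))\<^sup>2"
    using moreau_envelope_attained[OF wc bdd lam(1)] by blast
  define e where "e = norm (q - p)"
  have up: "?M y - ?M x - ((x - p) /\<^sub>R lam) \<bullet> (y - x) \<le> 1 / (2 * lam) * d\<^sup>2"
    using minq[of p] expand[of p] p by simp
  have "?M x + \<mu> / 2 * e\<^sup>2 \<le> f q + 1 / (2 * lam) * (norm (q - x))\<^sup>2"
    using prox_quadratic_growth[OF wc, of p lam x q] min p unfolding e_def \<mu>_def by simp
  moreover have "((q - p) \<bullet> (y - x)) / lam \<le> (e * d) / lam"
    unfolding e_def d_def using lam by (intro divide_right_mono norm_cauchy_schwarz) auto
  ultimately have "\<mu> / 2 * e\<^sup>2 - (e * d) / lam + 1 / (2 * lam) * d\<^sup>2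
      \<le> ?M y - ?M x - ((x - p) /\<^sub>R lam) \<bullet> (y - x)"
    using q expand[of q] by simp
  \<comment> \<open>Young's inequality: \<open>d / (lam * \<mu>)\<close> is the value of
    \<open>e\<close> at which \<open>\<mu> / 2 * e\<^sup>2 - (e * d) / lam\<close> is
    smallest.\<close>
  moreover have "(e * d) / lam \<le> \<mu> / 2 * e\<^sup>2 + 1 / (2 * lam\<^sup>2 * \<mu>) * d\<^sup>2"
  proof -
    have "0 \<le> \<mu> / 2 * (e - d / (lam * \<mu>))\<^sup>2"
      using \<mu> by simp
    also have "\<dots> = \<mu> / 2 * e\<^sup>2 - (e * d) / lam + 1 / (2 * lam\<^sup>2 * \<mu>) * d\<^sup>2"
      using \<mu> lam by (simp add: field_simps power2_eq_square)
    finally show ?thesis by simp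
  qed
  ultimately have "- (1 / (2 * lam\<^sup>2 * \<mu>) * d\<^sup>2) \<le> ?M y - ?M x - ((x - p) /\<^sub>R lam) \<bullet> (y - x)"
  proof -
    have "0 \<le> 1 / (2 * lam) * d\<^sup>2" using lam by simp
    with \<open>_ \<le> ?M y - ?M x - _\<close> \<open>(e * d) / lam \<le> _\<close> show ?thesis by linarith
  qed
  moreover have "0 \<le> 1 / (2 * lam) * d\<^sup>2" "0 \<le> 1 / (2 * lam\<^sup>2 * \<mu>) * d\<^sup>2"
    using lam \<mu> by simp_all
  \<comment> \<open>The constant adds the two one-sided ones, so it serves both signs.\<close>
  ultimately show "\<bar>?M y - ?M x - ((x - p) /\<^sub>R lam) \<bullet> (y - x)\<bar>
      \<le> (1 / (2 * lam) + 1 / (2 * lam\<^sup>2 * (1 / lam - \<rho>))) * (norm (y - x))\<^sup>2"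
    using up unfolding \<mu>_def[symmetric] d_def[symmetric] distrib_right by linarith
qed

section \<open>One subgradient step\<close>

text \<open>Quadratic growth at \<open>y = x\<close> bounds \<open>f p - f x\<close> by
  \<open>-(1 / lam - \<rho> / 2)\<close> times the squared distance from \<open>x\<close> to
  \<open>p\<close>; the subgradient inequality at \<open>p\<close> loses another
  \<open>\<rho> / 2\<close>. The remaining \<open>1 / lam - \<rho>\<close> is rescaled using that
  the gradient has norm \<open>norm (p - x) / lam\<close>.\<close>

lemma subgradient_step_correlation:
  fixes f :: "'a::euclidean_space \<Rightarrow> real"
  assumes wc: "weakly_convex \<rho> f" and bdd: "\<And>s. bounded {z. f z \<le> s}"
    and lam: "0 < lam" "lam * \<rho> < 1"
    and g: "g \<in> weak_subdiff \<rho> f x"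
    and p: "moreau_envelope lam f x = f p + 1 / (2 * lam) * (norm (p - x))\<^sup>2"
    and min: "\<And>y. moreau_envelope lam f x \<le> f y + 1 / (2 * lam) * (norm (y - x))\<^sup>2"
  shows "g \<bullet> (p - x) \<le> - (lam * (1 - lam * \<rho>) * (norm (gradient (moreau_envelope lam f) x))\<^sup>2)"
proof -
  let ?n = "(norm (p - x))\<^sup>2"
  have "norm (gradient (moreau_envelope lam f) x) = norm (p - x) / lam"
    using lam by (simp add: gradient_moreau_envelope[OF wc bdd lam p min] norm_minus_commute
        divide_inverse_commute)
  then have grad: "lam * (1 - lam * \<rho>) * (norm (gradient (moreau_envelope lam f) x))\<^sup>2
      = (1 / lam - \<rho>) * ?n"
    using lam(1) by (simp only:) (simp add: field_simps power2_eq_square)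
  have "f p + 1 / (2 * lam) * ?n + (1 / lam - \<rho>) / 2 * ?n \<le> f x"
    using prox_quadratic_growth[OF wc, of p lam x x] min p by (simp add: norm_minus_commute)
  moreover have "g \<bullet> (p - x) \<le> f p - f x + \<rho> / 2 * ?n"
    using weak_subdiffD[OF g, of p] by simp
  ultimately show ?thesis
    unfolding grad by (simp add: algebra_simps diff_divide_distrib)
qed

text \<open>Settles the iterates with a zero subgradient, where the step is not normalised: for
  \<open>g = 0\<close> the correlation bound leaves no room for a nonzero gradient.\<close>

lemma gradient_moreau_envelope_critical:
  fixes f :: "'a::euclidean_space \<Rightarrow> real"
  assumes wc: "weakly_convex \<rho> f" and bdd: "\<And>s. bounded {z. f z \<le> s}"
    and lam: "0 < lam" "lam * \<rho> < 1"
    and crit: "0 \<in> weak_subdiff \<rho> f x"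
  shows "gradient (moreau_envelope lam f) x = 0"
proof -
  obtain p where "moreau_envelope lam f x = f p + 1 / (2 * lam) * (norm (p - x))\<^sup>2"
    and "\<And>y. moreau_envelope lam f x \<le> f y + 1 / (2 * lam) * (norm (y - x))\<^sup>2"
    using moreau_envelope_attained[OF wc bdd lam(1)] by blast
  from subgradient_step_correlation[OF wc bdd lam crit this]
  have "lam * (1 - lam * \<rho>) * (norm (gradient (moreau_envelope lam f) x))\<^sup>2 \<le> 0"
    by simp
  moreover have "0 < lam * (1 - lam * \<rho>)"
    using lam by simp
  ultimately have "(norm (gradient (moreau_envelope lam f) x))\<^sup>2 \<le> 0"
    by (metis mult_le_cancel_left_pos mult_zero_right)
  then show ?thesis by simp
qed

lemma moreau_envelope_subgradient_step:
  fixes f :: "'a::euclidean_space \<Rightarrow> real"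
  assumes wc: "weakly_convex \<rho> f" and bdd: "\<And>s. bounded {z. f z \<le> s}"
    and lam: "0 < lam" "lam * \<rho> < 1"
    and g: "g \<in> weak_subdiff \<rho> f x" and "0 \<le> a"
  shows "moreau_envelope lam f (x - a *\<^sub>R g) \<le> moreau_envelope lam f x
    - a * (1 - lam * \<rho>) * (norm (gradient (moreau_envelope lam f) x))\<^sup>2
    + (norm (a *\<^sub>R g))\<^sup>2 / (2 * lam)"
proof -
  let ?M = "moreau_envelope lam f"
  let ?G = "(norm (gradient ?M x))\<^sup>2"
  obtain p where p: "?M x = f p + 1 / (2 * lam) * (norm (p - x))\<^sup>2"
    and min: "\<And>y. ?M x \<le> f y + 1 / (2 * lam) * (norm (y - x))\<^sup>2"
    using moreau_envelope_attained[OF wc bdd lam(1)] by blast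
  have "?M (x - a *\<^sub>R g) \<le> f p + 1 / (2 * lam) * (norm (p - (x - a *\<^sub>R g)))\<^sup>2"
    using moreau_envelope_attained[OF wc bdd lam(1)] by blast
  also have "(norm (p - (x - a *\<^sub>R g)))\<^sup>2
      = (norm (p - x))\<^sup>2 + 2 * a * (g \<bullet> (p - x)) + (norm (a *\<^sub>R g))\<^sup>2"
  proof -
    have "p - (x - a *\<^sub>R g) = (p - x) + a *\<^sub>R g" by simp
    then show ?thesis
      by (simp only: power2_norm_eq_inner)
        (simp add: inner_add_left inner_add_right inner_commute[of "p - x" g]
          distrib_left del: diff_add_eq)
  qed
  also have "f p + 1 / (2 * lam) * \<dots>
      = ?M x + a * (g \<bullet> (p - x)) / lam + (norm (a *\<^sub>R g))\<^sup>2 / (2 * lam)"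
    using p lam by (simp add: field_simps)
  finally have "?M (x - a *\<^sub>R g) \<le> \<dots>" .
  moreover have "a * (g \<bullet> (p - x)) / lam \<le> a * (- (lam * (1 - lam * \<rho>) * ?G)) / lam"
    using subgradient_step_correlation[OF wc bdd lam g p min] lam \<open>0 \<le> a\<close>
    by (intro divide_right_mono mult_left_mono) auto
  moreover have "a * (- (lam * (1 - lam * \<rho>) * ?G)) / lam = - (a * (1 - lam * \<rho>) * ?G)"
    using lam by simp
  ultimately show ?thesis by linarith
qed

section \<open>Bounded sublevel sets and the convergence rate\<close>

text \<open>The proximal point of \<open>z\<close> lies in the bounded set where \<open>f\<close> is
  at most \<open>s\<close>, and its penalty is at most \<open>s - m\<close>, which bounds its
  distance to \<open>z\<close>.\<close>

lemma bounded_moreau_envelope_sublevel: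
  fixes f :: "'a::euclidean_space \<Rightarrow> real"
  assumes wc: "weakly_convex \<rho> f" and bdd: "\<And>s. bounded {z. f z \<le> s}"
    and lam: "0 < lam" and lb: "\<And>y. m \<le> f y"
  shows "bounded {z. moreau_envelope lam f z \<le> s}"
proof -
  obtain R where R: "\<And>z. f z \<le> s \<Longrightarrow> norm z \<le> R"
    using bdd[of s] by (auto simp: bounded_iff)
  have "norm z \<le> R + sqrt (2 * lam * (s - m))" if z: "moreau_envelope lam f z \<le> s" for z
  proof -
    obtain p where p: "moreau_envelope lam f z = f p + 1 / (2 * lam) * (norm (p - z))\<^sup>2"
      using moreau_envelope_attained[OF wc bdd lam] by blast
    have "0 \<le> 1 / (2 * lam) * (norm (p - z))\<^sup>2" using lam by simp
    with p z have "norm p \<le> R" by (intro R) linarith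
    moreover have "1 / (2 * lam) * (norm (p - z))\<^sup>2 \<le> s - m"
      using p z lb[of p] by linarith
    then have "(norm (p - z))\<^sup>2 \<le> 2 * lam * (s - m)"
      using lam by (simp add: field_simps)
    then have "norm (p - z) \<le> sqrt (2 * lam * (s - m))"
      by (rule real_le_rsqrt)
    moreover have "norm z \<le> norm p + norm (p - z)"
      using norm_triangle_sub[of z p] by (simp add: norm_minus_commute)
    ultimately show ?thesis by linarith
  qed
  then show ?thesis by (auto simp: bounded_iff)
qed

theorem theorem2:
  fixes f :: "'a::euclidean_space \<Rightarrow> real"
    and \<rho> lam c fstar :: real
    and T :: nat
    and x g :: "nat \<Rightarrow> 'a"
    and \<alpha> \<beta> :: "nat \<Rightarrow> real"
    and B :: "'a set"
  assumes "\<rho> \<ge> 0"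
    and "weakly_convex \<rho> f"
    and "\<And>s. bounded {z. f z \<le> s}"
    and "{z. \<forall>y. f z \<le> f y} \<noteq> {}"
    and "fstar = min_value f"
    and "0 < lam"
    and "\<rho> > 0 \<Longrightarrow> lam < 1 / \<rho>"
    and "c > 0"
    and "\<And>k. k \<le> T \<Longrightarrow> g k \<in> weak_subdiff \<rho> f (x k)"
    and "\<And>k. k \<le> T \<Longrightarrow> \<beta> k = c / sqrt (real T + 1)"
    and "\<And>k. k \<le> T \<Longrightarrow> g k \<noteq> 0 \<Longrightarrow> \<alpha> k = \<beta> k / norm (g k)"
    and "\<And>k. k \<le> T \<Longrightarrow> x (Suc k) = x k - \<alpha> k *\<^sub>R g k"
    and "B = {z. moreau_envelope lam f z \<le> moreau_envelope lam f (x 0) + c\<^sup>2 / (2 * lam)}"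
  shows "bounded B \<and> (\<forall>k\<le>T. x k \<in> B) \<and>
    (\<forall>B' L. bounded B' \<longrightarrow> open B' \<longrightarrow> convex B' \<longrightarrow> B \<subseteq> B' \<longrightarrow> L > 0 \<longrightarrow> L-lipschitz_on B' f \<longrightarrow>
      (MIN k\<in>{0..T}. (norm (gradient (moreau_envelope lam f) (x k)))\<^sup>2)
        \<le> L * (moreau_envelope lam f (x 0) - fstar + c\<^sup>2 / (2 * lam))
            / (c * (1 - lam * \<rho>) * sqrt (real T + 1)))"
proof -
  let ?M = "moreau_envelope lam f"
  let ?G = "\<lambda>k. (norm (gradient ?M (x k)))\<^sup>2"
  define b where "b = c / sqrt (real T + 1)"
  note wc = assms(2) and bdd = assms(3) and lam0 = assms(6) and c = assms(8)
    and g = assms(9) and B = assms(13)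
  have lam: "lam * \<rho> < 1"
    using assms(1,6,7) by (cases "\<rho> = 0") (auto simp: field_simps)
  have b: "0 < b" and b2: "b\<^sup>2 = c\<^sup>2 / (real T + 1)"
    using c by (auto simp: b_def power_divide add_nonneg_pos)
  have fstar: "fstar \<le> f y" for y
  proof -
    from assms(4) obtain z where z: "\<And>y. f z \<le> f y" by auto
    with min_value_eqI[of f z] assms(5) show ?thesis by simp
  qed
  have M_ge: "fstar \<le> ?M z" for z
  proof -
    obtain p where "?M z = f p + 1 / (2 * lam) * (norm (p - z))\<^sup>2"
      using moreau_envelope_attained[OF wc bdd lam0] by blast
    moreover have "0 \<le> 1 / (2 * lam) * (norm (p - z))\<^sup>2" using lam0 by simp
    ultimately show ?thesis using fstar[of p] by linarith
  qed
  \<comment> \<open>A step with \<open>g k \<noteq> 0\<close> has length exactly \<open>b\<close>.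
    If \<open>g k = 0\<close>, the quotient \<open>b / norm (g k)\<close> is 0 and the iterate
    stays, so only the nonnegative error term remains.\<close>
  have step: "?M (x (Suc k)) \<le> ?M (x k) - b / norm (g k) * (1 - lam * \<rho>) * ?G k + b\<^sup>2 / (2 * lam)"
    if "k \<le> T" for k
  proof (cases "g k = 0")
    case True
    then show ?thesis using assms(12)[OF that] lam0 by simp
  next
    case False
    have "\<alpha> k = b / norm (g k)"
      using assms(10,11) that False by (simp add: b_def)
    then show ?thesis
      using moreau_envelope_subgradient_step[OF wc bdd lam0 lam g[OF that], of "\<alpha> k"]
        assms(12)[OF that] False b by simp
  qed
  \<comment> \<open>The range includes \<open>Suc T\<close>, so that all \<open>T + 1\<close>
    decreases can be summed for the rate.\<close>
  have sum: "?M (x k) + (\<Sum>i<k. b / norm (g i) * (1 - lam * \<rho>) * ?G i)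
      \<le> ?M (x 0) + real k * (b\<^sup>2 / (2 * lam))" if "k \<le> Suc T" for k
    using that
  proof (induction k)
    case (Suc k)
    then show ?case using step[of k] by (simp add: distrib_right add_divide_distrib)
  qed simp
  have nonneg: "0 \<le> b / norm (g i) * (1 - lam * \<rho>) * ?G i" for i
    using b lam by simp
  \<comment> \<open>The choice of \<open>b\<close> makes the accumulated error equal to the slack in
    \<open>B\<close>.\<close>
  have "real (Suc T) * b\<^sup>2 = c\<^sup>2"
    by (simp add: b2 add.commute add_nonneg_eq_0_iff)
  then have total: "real (Suc T) * (b\<^sup>2 / (2 * lam)) = c\<^sup>2 / (2 * lam)"
    by simp
  have in_B: "x k \<in> B" if "k \<le> T" for k
  proof -
    have "real k * (b\<^sup>2 / (2 * lam)) \<le> real (Suc T) * (b\<^sup>2 / (2 * lam))"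
      using that lam0 by (intro mult_right_mono) auto
    moreover have "0 \<le> (\<Sum>i<k. b / norm (g i) * (1 - lam * \<rho>) * ?G i)"
      using nonneg by (rule sum_nonneg)
    ultimately show ?thesis
      using sum[of k] that total unfolding B mem_Collect_eq by linarith
  qed
  have rate: "(MIN k\<in>{0..T}. ?G k)
      \<le> L * (?M (x 0) - fstar + c\<^sup>2 / (2 * lam)) / (c * (1 - lam * \<rho>) * sqrt (real T + 1))"
    if B': "open B'" "B \<subseteq> B'" and L: "L > 0" "L-lipschitz_on B' f" for B' L
  proof (cases "\<exists>k\<le>T. g k = 0")
    case True
    then obtain k where k: "k \<le> T" "g k = 0" by blast
    \<comment> \<open>A critical iterate makes the minimum 0, so it suffices that the right-hand
      side is nonnegative.\<close>
    then have "gradient ?M (x k) = 0"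
      using gradient_moreau_envelope_critical[OF wc bdd lam0 lam] g[OF k(1)] by simp
    then have "(MIN k\<in>{0..T}. ?G k) \<le> 0"
      using k by (intro Min.coboundedI) (auto intro!: image_eqI[of _ _ k])
    also have "0 \<le> L * (?M (x 0) - fstar + c\<^sup>2 / (2 * lam)) / (c * (1 - lam * \<rho>) * sqrt (real T + 1))"
      using L c lam lam0 M_ge[of "x 0"]
      by (intro divide_nonneg_nonneg mult_nonneg_nonneg add_nonneg_nonneg) auto
    finally show ?thesis .
  next
    case False
    let ?m = "MIN k\<in>{0..T}. ?G k"
    \<comment> \<open>Every \<open>g i\<close> is nonzero here, so \<open>norm (g i) \<le> L\<close>
      may be inverted. That bound holds because \<open>x i\<close> lies in \<open>B\<close> and
      hence in the open set \<open>B'\<close>.\<close>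
    have "b / L * (1 - lam * \<rho>) * ?m \<le> b / norm (g i) * (1 - lam * \<rho>) * ?G i" if "i < Suc T" for i
    proof -
      have "norm (g i) \<le> L"
        using weak_subgradient_norm_le[OF g[of i] B'(1) _ L(2)] in_B[of i] B'(2) that by auto
      then have coeff: "b / L * (1 - lam * \<rho>) \<le> b / norm (g i) * (1 - lam * \<rho>)"
        using b lam L False that by (intro mult_right_mono divide_left_mono) auto
      have m: "?m \<le> ?G i" "0 \<le> ?m"
        using that by (auto intro!: Min.coboundedI)
      show ?thesis
        using b lam by (intro mult_mono[OF coeff m(1) _ m(2)]) simp
    qed
    then have "(\<Sum>i<Suc T. b / L * (1 - lam * \<rho>) * ?m)
        \<le> (\<Sum>i<Suc T. b / norm (g i) * (1 - lam * \<rho>) * ?G i)"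
      by (intro sum_mono) simp
    also have "\<dots> \<le> ?M (x 0) - fstar + c\<^sup>2 / (2 * lam)"
      using sum[of "Suc T"] M_ge[of "x (Suc T)"] total by linarith
    finally have "(real T + 1) * b * (1 - lam * \<rho>) * ?m \<le> L * (?M (x 0) - fstar + c\<^sup>2 / (2 * lam))"
      using L by (simp add: field_simps)
    \<comment> \<open>The \<open>T + 1\<close> equal terms against \<open>b\<close> of order
      \<open>1 / sqrt (real T + 1)\<close> leave the factor \<open>sqrt (real T + 1)\<close> of the
      rate.\<close>
    moreover have "(real T + 1) * b = c * ((real T + 1) / sqrt (real T + 1))"
      by (simp add: b_def)
    then have "(real T + 1) * b = c * sqrt (real T + 1)"
      by (subst (asm) real_div_sqrt) auto
    ultimately have "?m * (c * (1 - lam * \<rho>) * sqrt (real T + 1))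
        \<le> L * (?M (x 0) - fstar + c\<^sup>2 / (2 * lam))"
      by (simp only:) (simp add: mult_ac)
    moreover have "0 < c * (1 - lam * \<rho>) * sqrt (real T + 1)"
      using c lam by (simp add: add_nonneg_pos)
    ultimately show ?thesis
      by (simp add: pos_le_divide_eq)
  qed
  show ?thesis
    using bounded_moreau_envelope_sublevel[OF wc bdd lam0 fstar] in_B rate unfolding B by blast
qed

end
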